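(* Let $N$ be a loop and $H$ a group, let $\phi: H\to Sym(N)_1$, $h\mapsto\phi_h$, be a group homomorphism (equivalently, a left action $h\ast n=\phi_h(n)$ of $H$ on $N$ fixing $1$). Let $L=\{(n,h)\mid n\in N,\ h\in H\}$ with binary operation $(n_1,h_1)\cdot(n_2,h_2)=(n_1\phi_{h_1}(n_2),\,h_1h_2)$. Then: (i) $L$ is a loop under $\cdot$, and $|L|=|N||H|$. (ii) The set $N'=\{(n,1)\mid n\in N\}$ is a loop and the set $H'=\{(1,h)\mid h\in H\}$ is a group (under $\cdot$), and the maps $h\mapsto(1,h)$ and $n\mapsto(n,1)$ are isomorphisms from $H$ to $H'$ and from $N$ to $N'$ respectively. Moreover, identifying $N$ with $N'$ and $H$ with $H'$ via these isomorphisms: (a) $N$ is a subloop of $L$ and $H$ is a subgroup of $L$; (b) $H\cap N=\{1\}$; (c) for all $h\in H$ and $n\in N$, $\phi_h(n)=h(nh^{-1})$, i.e. $(\phi_h(n),1)=(1,h)\cdot\big((n,1)\cdot(1,h)^{-1}\big)$.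
   Context: A loop is a non-empty set $L$ with a binary operation such that for all $a,b\in L$ the equations $x\cdot a=b$ and $a\cdot x=b$ have unique solutions $x$ in $L$, and there is a two-sided identity element (denoted $1$). A subloop is a non-empty subset that is itself a loop under the induced operation; a subgroup of a loop is a subloop that is a group. $Sym(N)$ is the group of all permutations of the set $N$, and $Sym(N)_1$ is the stabilizer of the identity $1\in N$ in $Sym(N)$. *)

theory Defs
  imports "HOL-Algebra.Group_Action"
begin

unbundle cardinal_syntax

locale loop =
  fixes G (structure)
  assumes m_closed: "\<lbrakk>x \<in> carrier G; y \<in> carrier G\<rbrakk> \<Longrightarrow> x \<otimes> y \<in> carrier G"
    and one_closed: "\<one> \<in> carrier G"
    and l_one: "x \<in> carrier G \<Longrightarrow> \<one> \<otimes> x = x"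
    and r_one: "x \<in> carrier G \<Longrightarrow> x \<otimes> \<one> = x"
    and left_division: "\<lbrakk>a \<in> carrier G; b \<in> carrier G\<rbrakk> \<Longrightarrow> \<exists>!x. x \<in> carrier G \<and> a \<otimes> x = b"
    and right_division: "\<lbrakk>a \<in> carrier G; b \<in> carrier G\<rbrakk> \<Longrightarrow> \<exists>!x. x \<in> carrier G \<and> x \<otimes> a = b"

text \<open>A subset is a subloop or a subgroup according to the induced operation alone: the identity
  of the substructure is not required in advance to be that of the ambient loop.\<close>

definition subloop :: "'a set \<Rightarrow> ('a, 'm) monoid_scheme \<Rightarrow> bool"
  where "subloop S G \<longleftrightarrow>
    S \<subseteq> carrier G \<and> S \<noteq> {} \<and> (\<exists>e. loop (G\<lparr>carrier := S, one := e\<rparr>))"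

definition subgroup_of_loop :: "'a set \<Rightarrow> ('a, 'm) monoid_scheme \<Rightarrow> bool"
  where "subgroup_of_loop S G \<longleftrightarrow>
    subloop S G \<and> (\<exists>e. group (G\<lparr>carrier := S, one := e\<rparr>))"

text \<open>The product of \<^term>\<open>g\<close> and \<^term>\<open>f\<close> in \<^const>\<open>BijGroup\<close> is \<open>g\<close> after \<open>f\<close>, so homomorphisms into it are left actions.\<close>

definition Sym1 :: "('a, 'm) monoid_scheme \<Rightarrow> ('a \<Rightarrow> 'a) monoid"
  where "Sym1 N = (BijGroup (carrier N))
    \<lparr>carrier := stabilizer (BijGroup (carrier N)) (\<lambda>f. f) \<one>\<^bsub>N\<^esub>\<rparr>"

definition loop_semidirect ::
    "('a, 'm) monoid_scheme \<Rightarrow> ('b, 'n) monoid_scheme \<Rightarrow> ('b \<Rightarrow> 'a \<Rightarrow> 'a) \<Rightarrow> ('a \<times> 'b) monoid"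
  where "loop_semidirect N H \<phi> =
    \<lparr>carrier = carrier N \<times> carrier H,
     mult = \<lambda>(n1, h1) (n2, h2). (n1 \<otimes>\<^bsub>N\<^esub> \<phi> h1 n2, h1 \<otimes>\<^bsub>H\<^esub> h2),
     one = (\<one>\<^bsub>N\<^esub>, \<one>\<^bsub>H\<^esub>)\<rparr>"

definition loop_factor :: "('a, 'm) monoid_scheme \<Rightarrow> ('b, 'n) monoid_scheme \<Rightarrow> ('a \<times> 'b) set"
  where "loop_factor N H = {(n, \<one>\<^bsub>H\<^esub>) | n. n \<in> carrier N}"

definition group_factor :: "('a, 'm) monoid_scheme \<Rightarrow> ('b, 'n) monoid_scheme \<Rightarrow> ('a \<times> 'b) set"
  where "group_factor N H = {(\<one>\<^bsub>N\<^esub>, h) | h. h \<in> carrier H}"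

end

theory Submission
  imports Defs
begin

text \<open>
  An equation in \<open>L\<close> determines the \<open>H\<close>-coordinate of the unknown by cancellation in the group \<open>H\<close>,
  and what remains is a single equation in \<open>N\<close>. For \<open>(n\<^sub>1, h\<^sub>1) \<cdot> (x, y) = (n\<^sub>2, h\<^sub>2)\<close> this is
  \<open>n\<^sub>1 \<phi>\<^bsub>h\<^sub>1\<^esub>(x) = n\<^sub>2\<close>: left division in \<open>N\<close> gives \<open>\<phi>\<^bsub>h\<^sub>1\<^esub>(x)\<close>, and bijectivity of \<open>\<phi>\<^bsub>h\<^sub>1\<^esub>\<close> gives \<open>x\<close>.
  For \<open>(x, y) \<cdot> (n\<^sub>1, h\<^sub>1) = (n\<^sub>2, h\<^sub>2)\<close> the coordinate \<open>y = h\<^sub>2 h\<^sub>1\<^sup>-\<^sup>1\<close> is known first, and then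
  \<open>x \<phi>\<^sub>y(n\<^sub>1) = n\<^sub>2\<close> is a right division in \<open>N\<close>. The two halves of \<open>(1, 1)\<close> being an identity
  come from \<open>\<phi>\<^sub>1 = id\<close> and from \<open>\<phi>\<^sub>h(1) = 1\<close>. This is \<open>loop_semidirect_is_loop\<close>.

  The two factors are the images of \<open>N\<close> and \<open>H\<close> under bijections that preserve multiplication,
  again because \<open>\<phi>\<^sub>1 = id\<close> and \<open>\<phi>\<^sub>h(1) = 1\<close>, so their loop and group structures are transported
  (\<open>iso_imp_img_loop\<close> and its analogue for groups). The conjugation formula is a computation
  once \<open>(1, h)\<^sup>-\<^sup>1 = (1, h\<^sup>-\<^sup>1)\<close> is known (\<open>inv_group_factor\<close>).
\<close>

text \<open>Unique solvability is a statement about the multiplication alone, so it passes through any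
  multiplicative bijection; this is the loop analogue of the corresponding fact for groups.\<close>

lemma (in loop) iso_imp_img_loop:
  assumes "f \<in> iso G K"
  shows "loop (K\<lparr>one := f \<one>\<rparr>)"
proof -
  have hom: "f (x \<otimes> y) = f x \<otimes>\<^bsub>K\<^esub> f y" if "x \<in> carrier G" "y \<in> carrier G" for x y
    using assms that by (auto simp: iso_def hom_def)
  have inj: "f x = f y \<longleftrightarrow> x = y" if "x \<in> carrier G" "y \<in> carrier G" for x y
    using assms that by (auto simp: iso_def bij_betw_def inj_on_def)
  have img: "carrier K = f ` carrier G"
    using assms by (auto simp: iso_def bij_betw_def)
  have ex1_image: "\<exists>!y. y \<in> f ` carrier G \<and> P y" if "\<exists>!x. x \<in> carrier G \<and> P (f x)" for P
  proof -
    from that obtain x where "x \<in> carrier G" "P (f x)"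
      and "\<And>x'. x' \<in> carrier G \<Longrightarrow> P (f x') \<Longrightarrow> x' = x"
      by blast
    then show ?thesis
      by (intro ex1I [of _ "f x"]) blast+
  qed
  show ?thesis
  proof (unfold_locales, simp_all add: img)
    fix a b assume "a \<in> f ` carrier G" "b \<in> f ` carrier G"
    then obtain a' b' where ab: "a' \<in> carrier G" "b' \<in> carrier G" "a = f a'" "b = f b'"
      by blast
    show "a \<otimes>\<^bsub>K\<^esub> b \<in> f ` carrier G"
      using ab by (simp add: hom [symmetric] m_closed)
    have "(a' \<otimes> x = b') = (a \<otimes>\<^bsub>K\<^esub> f x = b)" if "x \<in> carrier G" for x
      using ab that by (simp add: hom [symmetric] inj m_closed)
    with left_division [OF ab(1,2)] have "\<exists>!x. x \<in> carrier G \<and> a \<otimes>\<^bsub>K\<^esub> f x = b"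
      by (simp cong: conj_cong)
    then show "\<exists>!x. x \<in> f ` carrier G \<and> a \<otimes>\<^bsub>K\<^esub> x = b"
      by (rule ex1_image)
    have "(x \<otimes> a' = b') = (f x \<otimes>\<^bsub>K\<^esub> a = b)" if "x \<in> carrier G" for x
      using ab that by (simp add: hom [symmetric] inj m_closed)
    with right_division [OF ab(1,2)] have "\<exists>!x. x \<in> carrier G \<and> f x \<otimes>\<^bsub>K\<^esub> a = b"
      by (simp cong: conj_cong)
    then show "\<exists>!x. x \<in> f ` carrier G \<and> x \<otimes>\<^bsub>K\<^esub> a = b"
      by (rule ex1_image)
  qed (auto simp: hom [symmetric] one_closed l_one r_one)
qed

text \<open>Division by \<open>a\<close> in a group is multiplication by \<open>inv a\<close> on the respective side.\<close>

lemma (in group) group_is_loop: "loop G"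
proof unfold_locales
  fix a b assume ab: "a \<in> carrier G" "b \<in> carrier G"
  show "\<exists>!x. x \<in> carrier G \<and> a \<otimes> x = b"
    using ab by (intro ex1I [of _ "inv a \<otimes> b"]) (auto simp: m_assoc [symmetric])
  show "\<exists>!x. x \<in> carrier G \<and> x \<otimes> a = b"
    using ab by (intro ex1I [of _ "b \<otimes> inv a"]) (auto simp: m_assoc)
qed auto

locale loop_action = N: loop N + H: group H
  for N :: "('a, 'm) monoid_scheme" (structure)
    and H :: "('b, 'n) monoid_scheme" (structure) +
  fixes \<phi> :: "'b \<Rightarrow> 'a \<Rightarrow> 'a"
  assumes action: "\<phi> \<in> hom H (Sym1 N)"
begin

abbreviation "L \<equiv> loop_semidirect N H \<phi>"

lemma action_bij: "h \<in> carrier H \<Longrightarrow> bij_betw (\<phi> h) (carrier N) (carrier N)"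
  using action by (auto simp: hom_def Sym1_def stabilizer_def BijGroup_def Bij_def)

lemma action_fixes_one: "h \<in> carrier H \<Longrightarrow> \<phi> h \<one>\<^bsub>N\<^esub> = \<one>\<^bsub>N\<^esub>"
  using action by (auto simp: hom_def Sym1_def stabilizer_def)

lemma action_closed: "h \<in> carrier H \<Longrightarrow> n \<in> carrier N \<Longrightarrow> \<phi> h n \<in> carrier N"
  using action_bij by (auto dest: bij_betwE)

lemma action_inj:
  "h \<in> carrier H \<Longrightarrow> x \<in> carrier N \<Longrightarrow> y \<in> carrier N \<Longrightarrow> \<phi> h x = \<phi> h y \<longleftrightarrow> x = y"
  using action_bij by (auto simp: bij_betw_def inj_on_def)

lemma action_mult:
  assumes "g \<in> carrier H" "h \<in> carrier H" "n \<in> carrier N"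
  shows "\<phi> (g \<otimes>\<^bsub>H\<^esub> h) n = \<phi> g (\<phi> h n)"
proof -
  have "\<phi> k \<in> Bij (carrier N)" if "k \<in> carrier H" for k
    using action that by (auto simp: hom_def Sym1_def stabilizer_def BijGroup_def)
  moreover have "\<phi> (g \<otimes>\<^bsub>H\<^esub> h) = \<phi> g \<otimes>\<^bsub>Sym1 N\<^esub> \<phi> h"
    using action assms by (auto simp: hom_def)
  ultimately show ?thesis
    using assms by (simp add: Sym1_def BijGroup_def compose_eq)
qed

text \<open>The permutation that the identity of \<open>H\<close> induces is idempotent, and an injective idempotent map is the identity.\<close>

lemma action_one:
  assumes n: "n \<in> carrier N"
  shows "\<phi> \<one>\<^bsub>H\<^esub> n = n"
proof -
  have "\<phi> \<one>\<^bsub>H\<^esub> (\<phi> \<one>\<^bsub>H\<^esub> n) = \<phi> \<one>\<^bsub>H\<^esub> n"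
    using action_mult [OF H.one_closed H.one_closed n] by simp
  then show ?thesis
    using action_inj [OF H.one_closed action_closed [OF H.one_closed n] n] by blast
qed

lemma carrier_semidirect [simp]: "carrier L = carrier N \<times> carrier H"
  and mult_semidirect [simp]:
    "(n1, h1) \<otimes>\<^bsub>L\<^esub> (n2, h2) = (n1 \<otimes>\<^bsub>N\<^esub> \<phi> h1 n2, h1 \<otimes>\<^bsub>H\<^esub> h2)"
  and one_semidirect [simp]: "\<one>\<^bsub>L\<^esub> = (\<one>\<^bsub>N\<^esub>, \<one>\<^bsub>H\<^esub>)"
  by (simp_all add: loop_semidirect_def)

lemma loop_semidirect_is_loop: "loop L"
proof (unfold_locales)
  fix a b assume "a \<in> carrier L" "b \<in> carrier L"
  then obtain n1 h1 n2 h2 where ab: "a = (n1, h1)" "b = (n2, h2)"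
    and n: "n1 \<in> carrier N" "n2 \<in> carrier N" and h: "h1 \<in> carrier H" "h2 \<in> carrier H"
    by auto
  show "a \<otimes>\<^bsub>L\<^esub> b \<in> carrier L"
    using n h by (simp add: ab N.m_closed action_closed)
  show "\<exists>!x. x \<in> carrier L \<and> a \<otimes>\<^bsub>L\<^esub> x = b"
  proof -
    from N.left_division [OF n] obtain y where y: "y \<in> carrier N" "n1 \<otimes>\<^bsub>N\<^esub> y = n2"
      and uy: "\<And>y'. y' \<in> carrier N \<Longrightarrow> n1 \<otimes>\<^bsub>N\<^esub> y' = n2 \<Longrightarrow> y' = y" by blast
    from action_bij [OF h(1)] y(1) obtain x where x: "x \<in> carrier N" "\<phi> h1 x = y"
      by (metis bij_betw_imp_surj_on imageE)
    show ?thesis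
    proof (rule ex1I [of _ "(x, inv\<^bsub>H\<^esub> h1 \<otimes>\<^bsub>H\<^esub> h2)"])
      show "(x, inv\<^bsub>H\<^esub> h1 \<otimes>\<^bsub>H\<^esub> h2) \<in> carrier L \<and> a \<otimes>\<^bsub>L\<^esub> (x, inv\<^bsub>H\<^esub> h1 \<otimes>\<^bsub>H\<^esub> h2) = b"
        using x y h by (simp add: ab H.m_assoc [symmetric])
    next
      fix p assume "p \<in> carrier L \<and> a \<otimes>\<^bsub>L\<^esub> p = b"
      then obtain u v where p: "p = (u, v)" "u \<in> carrier N" "v \<in> carrier H"
        "n1 \<otimes>\<^bsub>N\<^esub> \<phi> h1 u = n2" "h1 \<otimes>\<^bsub>H\<^esub> v = h2"
        by (auto simp: ab)
      have "\<phi> h1 u = \<phi> h1 x"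
        using uy p h x by (simp add: action_closed)
      then show "p = (x, inv\<^bsub>H\<^esub> h1 \<otimes>\<^bsub>H\<^esub> h2)"
        using p x h by (auto simp: action_inj H.m_assoc [symmetric])
    qed
  qed
  show "\<exists>!x. x \<in> carrier L \<and> x \<otimes>\<^bsub>L\<^esub> a = b"
  proof -
    define y where "y = h2 \<otimes>\<^bsub>H\<^esub> inv\<^bsub>H\<^esub> h1"
    have y: "y \<in> carrier H" "y \<otimes>\<^bsub>H\<^esub> h1 = h2"
      using h by (simp_all add: y_def H.m_assoc)
    from N.right_division [OF action_closed [OF y(1) n(1)] n(2)]
    obtain x where x: "x \<in> carrier N" "x \<otimes>\<^bsub>N\<^esub> \<phi> y n1 = n2"
      and ux: "\<And>x'. x' \<in> carrier N \<Longrightarrow> x' \<otimes>\<^bsub>N\<^esub> \<phi> y n1 = n2 \<Longrightarrow> x' = x" by blast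
    show ?thesis
    proof (rule ex1I [of _ "(x, y)"])
      show "(x, y) \<in> carrier L \<and> (x, y) \<otimes>\<^bsub>L\<^esub> a = b"
        using x y by (simp add: ab)
    next
      fix p assume "p \<in> carrier L \<and> p \<otimes>\<^bsub>L\<^esub> a = b"
      then obtain u v where p: "p = (u, v)" "u \<in> carrier N" "v \<in> carrier H"
        "u \<otimes>\<^bsub>N\<^esub> \<phi> v n1 = n2" "v \<otimes>\<^bsub>H\<^esub> h1 = h2"
        by (auto simp: ab)
      then have "v = y"
        using y h by (metis H.right_cancel)
      then show "p = (x, y)"
        using p ux by simp
    qed
  qed
qed (auto simp: N.one_closed N.l_one N.r_one action_one action_fixes_one)

lemma iso_loop_factor: "(\<lambda>n. (n, \<one>\<^bsub>H\<^esub>)) \<in> iso N (L\<lparr>carrier := loop_factor N H\<rparr>)"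
  by (auto simp: iso_def hom_def bij_betw_def inj_on_def loop_factor_def N.m_closed action_one)

lemma iso_group_factor: "(\<lambda>h. (\<one>\<^bsub>N\<^esub>, h)) \<in> iso H (L\<lparr>carrier := group_factor N H\<rparr>)"
  by (auto simp: iso_def hom_def bij_betw_def inj_on_def group_factor_def
      N.one_closed N.l_one action_fixes_one)

lemma loop_loop_factor: "loop (L\<lparr>carrier := loop_factor N H\<rparr>)"
  using N.iso_imp_img_loop [OF iso_loop_factor] by (simp add: loop_semidirect_def)

lemma group_group_factor: "group (L\<lparr>carrier := group_factor N H\<rparr>)"
  using H.iso_imp_img_group [OF iso_group_factor] by (simp add: loop_semidirect_def)

lemma subloop_loop_factor: "subloop (loop_factor N H) L"
proof -
  have "L\<lparr>carrier := loop_factor N H, one := \<one>\<^bsub>L\<^esub>\<rparr> = L\<lparr>carrier := loop_factor N H\<rparr>"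
    by (simp add: loop_semidirect_def)
  then have "loop (L\<lparr>carrier := loop_factor N H, one := \<one>\<^bsub>L\<^esub>\<rparr>)"
    using loop_loop_factor by (simp only:)
  then show ?thesis
    unfolding subloop_def by (auto simp: loop_factor_def intro: N.one_closed)
qed

lemma subgroup_group_factor: "subgroup_of_loop (group_factor N H) L"
proof -
  have "L\<lparr>carrier := group_factor N H, one := \<one>\<^bsub>L\<^esub>\<rparr> = L\<lparr>carrier := group_factor N H\<rparr>"
    by (simp add: loop_semidirect_def)
  then have grp: "group (L\<lparr>carrier := group_factor N H, one := \<one>\<^bsub>L\<^esub>\<rparr>)"
    using group_group_factor by (simp only:)
  then have "subloop (group_factor N H) L"
    using group.group_is_loop [OF grp] unfolding subloop_def
    by (auto simp: group_factor_def intro: N.one_closed)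
  with grp show ?thesis
    unfolding subgroup_of_loop_def by blast
qed

text \<open>In a loop a two-sided inverse may fail to exist, and then \<^const>\<open>m_inv\<close>, a definite
  description, says nothing; so the candidate has to be checked from both sides and shown unique. For \<open>(1, h)\<close> the equation \<open>(1, h) \<cdot> (u, v) = (1, 1)\<close> reads \<open>\<phi>\<^sub>h(u) = 1\<close> and \<open>h v = 1\<close>; the
  first forces \<open>u = 1\<close>, because \<open>\<phi>\<^sub>h\<close> is injective and fixes \<open>1\<close>.\<close>

lemma inv_group_factor:
  assumes h: "h \<in> carrier H"
  shows "inv\<^bsub>L\<^esub> (\<one>\<^bsub>N\<^esub>, h) = (\<one>\<^bsub>N\<^esub>, inv\<^bsub>H\<^esub> h)"
  unfolding m_inv_def [of L]
proof (rule the_equality)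
  show "(\<one>\<^bsub>N\<^esub>, inv\<^bsub>H\<^esub> h) \<in> carrier L \<and> (\<one>\<^bsub>N\<^esub>, h) \<otimes>\<^bsub>L\<^esub> (\<one>\<^bsub>N\<^esub>, inv\<^bsub>H\<^esub> h) = \<one>\<^bsub>L\<^esub>
      \<and> (\<one>\<^bsub>N\<^esub>, inv\<^bsub>H\<^esub> h) \<otimes>\<^bsub>L\<^esub> (\<one>\<^bsub>N\<^esub>, h) = \<one>\<^bsub>L\<^esub>"
    using h by (simp add: N.one_closed N.l_one action_fixes_one)
next
  fix p
  assume p: "p \<in> carrier L \<and> (\<one>\<^bsub>N\<^esub>, h) \<otimes>\<^bsub>L\<^esub> p = \<one>\<^bsub>L\<^esub> \<and> p \<otimes>\<^bsub>L\<^esub> (\<one>\<^bsub>N\<^esub>, h) = \<one>\<^bsub>L\<^esub>"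
  then obtain u v where uv: "p = (u, v)" "u \<in> carrier N" "v \<in> carrier H"
    "\<phi> h u = \<one>\<^bsub>N\<^esub>" "v \<otimes>\<^bsub>H\<^esub> h = \<one>\<^bsub>H\<^esub>"
    using h by (auto simp: N.l_one action_closed)
  have "u = \<one>\<^bsub>N\<^esub>"
    using uv h action_inj [of h u "\<one>\<^bsub>N\<^esub>"] by (simp add: N.one_closed action_fixes_one)
  moreover have "v = inv\<^bsub>H\<^esub> h"
    using uv h by (simp add: H.inv_equality)
  ultimately show "p = (\<one>\<^bsub>N\<^esub>, inv\<^bsub>H\<^esub> h)"
    using uv by simp
qed

lemma action_as_conjugation:
  assumes "h \<in> carrier H" "n \<in> carrier N"
  shows "(\<one>\<^bsub>N\<^esub>, h) \<otimes>\<^bsub>L\<^esub> ((n, \<one>\<^bsub>H\<^esub>) \<otimes>\<^bsub>L\<^esub> inv\<^bsub>L\<^esub> (\<one>\<^bsub>N\<^esub>, h)) = (\<phi> h n, \<one>\<^bsub>H\<^esub>)"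
  using assms
  by (simp add: inv_group_factor action_fixes_one action_closed N.l_one N.r_one)

lemma factors_Int: "group_factor N H \<inter> loop_factor N H = {\<one>\<^bsub>L\<^esub>}"
  by (auto simp: group_factor_def loop_factor_def N.one_closed)

lemma card_semidirect: "|carrier L| =o |carrier N| *c |carrier H|"
  by (simp add: cprod_def Field_card_of card_of_refl)

lemma order_semidirect: "order L = order N * order H"
  by (simp add: order_def card_cartesian_product)

end

theorem theorem3p1:
  fixes N :: "('a, 'm) monoid_scheme"
    and H :: "('b, 'n) monoid_scheme"
    and \<phi> :: "'b \<Rightarrow> 'a \<Rightarrow> 'a"
  assumes "loop N"
    and "group H"
    and "\<phi> \<in> hom H (Sym1 N)"
  shows "let L = loop_semidirect N H \<phi>; N' = loop_factor N H; H' = group_factor N H in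
      (loop L \<and> |carrier L| =o |carrier N| *c |carrier H|
        \<and> order L = order N * order H) \<and>
      (loop (L\<lparr>carrier := N'\<rparr>) \<and> group (L\<lparr>carrier := H'\<rparr>)
        \<and> (\<lambda>h. (\<one>\<^bsub>N\<^esub>, h)) \<in> iso H (L\<lparr>carrier := H'\<rparr>)
        \<and> (\<lambda>n. (n, \<one>\<^bsub>H\<^esub>)) \<in> iso N (L\<lparr>carrier := N'\<rparr>)) \<and>
      (subloop N' L \<and> subgroup_of_loop H' L) \<and>
      H' \<inter> N' = {\<one>\<^bsub>L\<^esub>} \<and>
      (\<forall>h \<in> carrier H. \<forall>n \<in> carrier N.
        (\<phi> h n, \<one>\<^bsub>H\<^esub>) = (\<one>\<^bsub>N\<^esub>, h) \<otimes>\<^bsub>L\<^esub> ((n, \<one>\<^bsub>H\<^esub>) \<otimes>\<^bsub>L\<^esub> inv\<^bsub>L\<^esub> (\<one>\<^bsub>N\<^esub>, h)))"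
proof -
  interpret loop_action N H \<phi>
    using assms by (simp add: loop_action_def loop_action_axioms_def)
  show ?thesis
    unfolding Let_def
    using loop_semidirect_is_loop card_semidirect order_semidirect loop_loop_factor
      group_group_factor iso_group_factor iso_loop_factor subloop_loop_factor
      subgroup_group_factor factors_Int action_as_conjugation
    by simp
qed

end
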